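(* Let $X$ be a locally convex Hausdorff real topological vector space, let $(A_i)_{i\in I}$ be a family of nonempty $w^*$-closed convex subsets of $X^*$ and let $t_i\in\mathbb R$ for each $i\in I$. Assume that $0_{X^*}\in\bigcap_{i\in I}A_i$, that $\sup_{i\in I}t_i\le 0$, and that there exists $i_0\in I$ such that the indicator function $\delta_{A_{i_0}}$ is Mackey quasicontinuous. Then for each $\overline{x}^*\in X^*$ such that $$\overline{\operatorname{cone}}\Big(\bigcup_{J\in\mathcal F(I)}\sum_{j\in J}A_j-\overline{x}^*\Big)\ \text{ is a linear subspace of }X^*,$$ we have $$\min_{x\in X}\Big(\sum\nolimits_{i\in I}^{R}(\sigma_{A_i}(x)-t_i)-\langle\overline{x}^*,x\rangle\Big)=\sup\Big\{-\sum_{j\in J}t_j: J\in\mathcal F(I),\ \overline{x}^*\in\sum_{j\in J}A_j\Big\},$$ where writing $\min$ asserts that the infimum over $X$ is attained.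
   Context: $X^*$ is the topological dual of $X$, equipped with the weak$^*$ topology, and $\langle x^*,x\rangle$ the duality pairing. $I$ is an infinite index set and $\mathcal F(I)$ is the collection of all nonempty finite subsets of $I$. The robust sum of functions $f_i:X\to\mathbb R\cup\{+\infty\}$ is $\sum_{i\in I}^R f_i(x):=\sup_{J\in\mathcal F(I)}\sum_{i\in J}f_i(x)$. For $A\subset X^*$ nonempty, $\sigma_A(x)=\sup_{a^*\in A}\langle a^*,x\rangle$ ($x\in X$), and $\delta_A$ is the indicator function ($0$ on $A$, $+\infty$ elsewhere). $\operatorname{cone}A$ is the cone generated by $A\cup\{0\}$, i.e. $\{ta:t\ge0,\ a\in A\}$ for $A\neq\emptyset$, and $\overline{\operatorname{cone}}A$ is its weak$^*$ closure. Sums of sets are Minkowski sums. A convex function $\xi:X^*\to\overline{\mathbb R}$ is Mackey quasicontinuous (i.e. $\tau(X^*,X)$-quasicontinuous, where $\tau(X^*,X)$ is the Mackey topology on $X^*$) if: the affine hull $\operatorname{aff}\operatorname{dom}\xi$ is $\tau(X^*,X)$-closed; $\operatorname{aff}\operatorname{dom}\xi$ is of finite codimension; the $\tau(X^*,X)$-relative interior $\operatorname{ri}\operatorname{dom}\xi$ (the interior of $\operatorname{dom}\xi$ relative to $\operatorname{aff}\operatorname{dom}\xi$) is nonempty; and the restriction of $\xi$ to $\operatorname{aff}\operatorname{dom}\xi$ is $\tau(X^*,X)$-continuous on $\operatorname{ri}\operatorname{dom}\xi$. Here $\operatorname{dom}\xi=\{x^*:\xi(x^* )<+\infty\}$. 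*)

theory Defs
  imports "HOL-Analysis.Analysis" "HOL-Library.Set_Algebras"
begin

section \<open>Locally convex Hausdorff spaces and their duals\<close>

class topological_real_vector = real_vector + topological_ab_group_add +
  assumes tendsto_scaleR_nhds:
    "filterlim (\<lambda>p. fst p *\<^sub>R snd p) (nhds (c *\<^sub>R x)) (nhds c \<times>\<^sub>F nhds x)"

text \<open>
  The last condition on \<open>V\<close> says \<^term>\<open>convex V\<close>, see the lemma below; the constant
  \<^const>\<open>convex\<close> itself cannot occur in a class specification.
\<close>

class locally_convex_t2_space = topological_real_vector + t2_space +
  assumes locally_convex_raw:
    "open U \<Longrightarrow> 0 \<in> U \<Longrightarrow>
       \<exists>V. open V \<and> 0 \<in> V \<and> V \<subseteq> U \<and>
         (\<forall>x\<in>V. \<forall>y\<in>V. \<forall>u\<ge>0. \<forall>v\<ge>0. u + v = 1 \<longrightarrow> u *\<^sub>R x + v *\<^sub>R y \<in> V)"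

lemma locally_convex:
  fixes U :: "'a::locally_convex_t2_space set"
  assumes "open U" "0 \<in> U"
  shows "\<exists>V. open V \<and> 0 \<in> V \<and> V \<subseteq> U \<and> convex V"
  using locally_convex_raw[OF assms] unfolding convex_def .

instance real_normed_vector \<subseteq> locally_convex_t2_space
proof
  fix c :: real and x :: 'a
  show "filterlim (\<lambda>p. fst p *\<^sub>R snd p) (nhds (c *\<^sub>R x)) (nhds c \<times>\<^sub>F nhds x)"
    by (intro tendsto_scaleR filterlim_fst filterlim_snd)
next
  fix U :: "'a set"
  assume "open U" "0 \<in> U"
  then obtain e where e: "e > 0" "ball 0 e \<subseteq> U"
    using open_contains_ball by blast
  have "open (ball (0::'a) e) \<and> 0 \<in> ball (0::'a) e \<and> ball 0 e \<subseteq> U \<and> convex (ball (0::'a) e)"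
    using e by simp
  then show "\<exists>V. open V \<and> 0 \<in> V \<and> V \<subseteq> U \<and>
      (\<forall>x\<in>V. \<forall>y\<in>V. \<forall>u\<ge>0. \<forall>v\<ge>0. u + v = 1 \<longrightarrow> u *\<^sub>R x + v *\<^sub>R y \<in> V)"
    unfolding convex_def by blast
qed

typedef (overloaded) 'a dual =
    "{f :: 'a::locally_convex_t2_space \<Rightarrow> real. linear f \<and> continuous_on UNIV f}"
  morphisms pairing Abs_dual
  by (rule exI[of _ "\<lambda>_. 0"]) (simp add: linear_iff)

setup_lifting type_definition_dual

lemma dual_eqI: "(\<And>x. pairing f x = pairing g x) \<Longrightarrow> f = g"
  by (metis ext pairing_inject)

instantiation dual :: (locally_convex_t2_space) real_vector
begin

lift_definition zero_dual :: "'a dual" is "\<lambda>_. 0"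
  by (simp add: linear_iff)

lift_definition plus_dual :: "'a dual \<Rightarrow> 'a dual \<Rightarrow> 'a dual" is "\<lambda>f g x. f x + g x"
  by (auto simp: linear_iff algebra_simps intro: continuous_on_add)

lift_definition uminus_dual :: "'a dual \<Rightarrow> 'a dual" is "\<lambda>f x. - f x"
  by (auto simp: linear_iff intro: continuous_on_minus)

lift_definition minus_dual :: "'a dual \<Rightarrow> 'a dual \<Rightarrow> 'a dual" is "\<lambda>f g x. f x - g x"
  by (auto simp: linear_iff algebra_simps intro: continuous_on_diff)

lift_definition scaleR_dual :: "real \<Rightarrow> 'a dual \<Rightarrow> 'a dual" is "\<lambda>c f x. c * f x"
  by (auto simp: linear_iff algebra_simps intro: continuous_on_mult_left)

instance
  by standard (transfer; simp add: fun_eq_iff algebra_simps)+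

end

definition weak_topology :: "'a::locally_convex_t2_space topology" where
  "weak_topology = pullback_topology UNIV (\<lambda>x f. pairing f x) (powertop_real UNIV)"

definition weak_star_topology :: "'a::locally_convex_t2_space dual topology" where
  "weak_star_topology = pullback_topology UNIV pairing (powertop_real UNIV)"

text \<open>
  The Mackey topology \<open>\<tau>(X\<^sup>*, X)\<close> is the topology of uniform convergence on the
  weakly compact, convex, balanced subsets of \<open>X\<close>. The set generated by
  \<open>f\<close>, \<open>K\<close>, \<open>e\<close> below is the open ball of radius \<open>e\<close> around \<open>f\<close> for the seminorm
  \<open>g \<mapsto> sup {\<bar>pairing g x\<bar> | x. x \<in> K}\<close>: the supremum is attained on a nonempty weakly
  compact \<open>K\<close>, so the strict inequality may be required pointwise.
\<close>

definition mackey_topology :: "'a::locally_convex_t2_space dual topology" where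
  "mackey_topology = topology_generated_by
     {{g. \<forall>x\<in>K. \<bar>pairing g x - pairing f x\<bar> < e} | f K e.
        0 < e \<and> compactin weak_topology K \<and> convex K \<and>
        (\<forall>c x. \<bar>c\<bar> \<le> 1 \<longrightarrow> x \<in> K \<longrightarrow> c *\<^sub>R x \<in> K)}"


section \<open>Extended-real-valued functions\<close>

definition support_fun :: "'a::locally_convex_t2_space dual set \<Rightarrow> 'a \<Rightarrow> ereal" where
  "support_fun A x = (SUP f\<in>A. ereal (pairing f x))"

definition indicator_fun :: "'b set \<Rightarrow> 'b \<Rightarrow> ereal" where
  "indicator_fun A y = (if y \<in> A then 0 else \<infinity>)"

definition eff_dom :: "('b \<Rightarrow> ereal) \<Rightarrow> 'b set" where
  "eff_dom \<xi> = {y. \<xi> y < \<infinity>}"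

definition convex_fun :: "('b::real_vector \<Rightarrow> ereal) \<Rightarrow> bool" where
  "convex_fun \<xi> \<longleftrightarrow> convex {(y, r :: real). \<xi> y \<le> ereal r}"

definition nonempty_finite_subsets :: "'i set \<Rightarrow> 'i set set" where
  "nonempty_finite_subsets I = {J. J \<subseteq> I \<and> finite J \<and> J \<noteq> {}}"

text \<open>Intended for summands that do not take the value \<open>-\<infinity>\<close>.\<close>

definition robust_sum :: "'i set \<Rightarrow> ('i \<Rightarrow> 'b \<Rightarrow> ereal) \<Rightarrow> 'b \<Rightarrow> ereal" where
  "robust_sum I \<phi> x = (SUP J\<in>nonempty_finite_subsets I. \<Sum>i\<in>J. \<phi> i x)"

definition is_attained_min :: "('b \<Rightarrow> ereal) \<Rightarrow> ereal \<Rightarrow> bool" where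
  "is_attained_min \<phi> m \<longleftrightarrow> (INF x. \<phi> x) = m \<and> (\<exists>x. \<phi> x = m)"


section \<open>Mackey quasicontinuity\<close>

text \<open>The codimension of an affine set is that of its direction space.\<close>

definition finite_codimension :: "'b::real_vector set \<Rightarrow> bool" where
  "finite_codimension S \<longleftrightarrow> (\<exists>B. finite B \<and> span ({u - v | u v. u \<in> S \<and> v \<in> S} \<union> B) = UNIV)"

definition mackey_ri :: "'a::locally_convex_t2_space dual set \<Rightarrow> 'a dual set" where
  "mackey_ri S = subtopology mackey_topology (affine hull S) interior_of S"

definition mackey_quasicontinuous ::
    "('a::locally_convex_t2_space dual \<Rightarrow> ereal) \<Rightarrow> bool" where
  "mackey_quasicontinuous \<xi> \<longleftrightarrow>
     convex_fun \<xi> \<and>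
     closedin mackey_topology (affine hull eff_dom \<xi>) \<and>
     finite_codimension (affine hull eff_dom \<xi>) \<and>
     mackey_ri (eff_dom \<xi>) \<noteq> {} \<and>
     (\<forall>f\<in>mackey_ri (eff_dom \<xi>).
        topcontinuous_at (subtopology mackey_topology (affine hull eff_dom \<xi>)) euclidean \<xi> f)"

end

theory Submission
  imports Defs
begin

text \<open>
  Every \<open>A\<^sub>i\<close> contains \<open>0\<close> and every \<open>t\<^sub>i\<close> is nonpositive, so enlarging \<open>J\<close> enlarges
  both \<open>\<Sum>j\<in>J. A\<^sub>j\<close> and \<open>- \<Sum>j\<in>J. t\<^sub>j\<close>. Once the dual point \<open>z\<close> (the given
  functional) lies in one of the finite sums, the function to be minimised therefore takes the
  value of the supremum already at \<open>x = 0\<close>, which matches weak duality.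

  That \<open>z\<close> lies in the convex set \<open>C = \<Union>J. \<Sum>j\<in>J. A\<^sub>j\<close> is shown by separation. If
  \<open>z \<notin> C\<close>, the convex cone \<open>P\<close> generated by \<open>C - z\<close> contains \<open>- z\<close> but not \<open>z\<close>.
  As the linear hull \<open>M\<close> of the quasicontinuous \<open>A\<^sub>i\<close> has finite codimension and
  \<open>A\<^sub>i\<close> has Mackey interior in \<open>M\<close>, the cone \<open>P\<close> has an algebraic relative interior point,
  and Hahn-Banach gives a linear \<open>F \<le> 0\<close> on \<open>P\<close> that does not vanish on \<open>P\<close>. On \<open>M\<close>,
  \<open>F\<close> is bounded on a Mackey neighbourhood, hence given by a point of \<open>X\<close> (the argument of the
  Mackey-Arens theorem); since \<open>M\<close> is closed of finite codimension, \<open>F\<close> is given by a point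
  of \<open>X\<close> on all of the dual. So \<open>F\<close> is weak-star continuous, is \<open>\<le> 0\<close> on the closure of
  \<open>P\<close>, and cannot be negative anywhere on that linear subspace, a contradiction.
\<close>

section \<open>The Hahn-Banach theorem and convex cones\<close>

definition sublinear :: "('b::real_vector \<Rightarrow> real) \<Rightarrow> bool" where
  "sublinear p \<longleftrightarrow> (\<forall>x y. p (x + y) \<le> p x + p y) \<and> (\<forall>c x. 0 \<le> c \<longrightarrow> p (c *\<^sub>R x) = c * p x)"

lemma sublinear_add: "sublinear p \<Longrightarrow> p (x + y) \<le> p x + p y"
  and sublinear_scale: "sublinear p \<Longrightarrow> 0 \<le> c \<Longrightarrow> p (c *\<^sub>R x) = c * p x"
  by (auto simp: sublinear_def)

lemma sublinear_zero: "sublinear p \<Longrightarrow> p 0 = 0"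
  using sublinear_scale[of p 0 0] by simp

lemma sublinear_lower: "sublinear p \<Longrightarrow> - p (- x) \<le> p x"
  using sublinear_add[of p x "- x"] sublinear_zero[of p] by simp

text \<open>The pairs in \<open>R\<close> form a convex cone above the bound \<open>b\<close>, and
  the infimum over its fibres is sublinear. This serves the minimality argument, the chains in
  Zorn's lemma and the gauge of a cone.\<close>

lemma sublinear_Inf:
  fixes R :: "'b::real_vector \<Rightarrow> real \<Rightarrow> bool"
  assumes ex: "\<And>x. \<exists>s. R x s"
    and lower: "\<And>x s. R x s \<Longrightarrow> b x \<le> s"
    and add: "\<And>x y s t. R x s \<Longrightarrow> R y t \<Longrightarrow> R (x + y) (s + t)"
    and scale: "\<And>c x s. 0 < c \<Longrightarrow> R x s \<Longrightarrow> R (c *\<^sub>R x) (c * s)"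
  shows "sublinear (\<lambda>x. Inf {s. R x s})"
proof -
  define u where "u x = Inf {s. R x s}" for x
  have le: "u x \<le> s" if "R x s" for x s
    unfolding u_def using that lower by (intro cInf_lower bdd_belowI[of _ "b x"]) auto
  have ge: "z \<le> u x" if "\<And>s. R x s \<Longrightarrow> z \<le> s" for x z
    unfolding u_def using that ex[of x] by (intro cInf_greatest) auto
  have sub: "u (x + y) \<le> u x + u y" for x y
  proof -
    have "u (x + y) - t \<le> u x" if "R y t" for t
      using le[OF add[OF _ that]] by (intro ge) (simp add: diff_le_eq)
    then have "u (x + y) - u x \<le> u y"
      by (intro ge) (simp add: algebra_simps)
    then show ?thesis by simp
  qed
  have le_scale: "u (c *\<^sub>R x) \<le> c * u x" if c: "0 < c" for c x
  proof -
    have "u (c *\<^sub>R x) / c \<le> u x"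
      using le[OF scale[OF c]] c by (intro ge) (simp add: divide_le_eq mult.commute)
    then show ?thesis using c by (simp add: divide_le_eq mult.commute)
  qed
  have hom: "u (c *\<^sub>R x) = c * u x" if "0 \<le> c" for c x
  proof (cases "c = 0")
    case True
    \<comment> \<open>The factor 2 gives \<open>u 0 \<ge> 0\<close>, the factor 1/2 gives
      \<open>u 0 \<le> 0\<close>.\<close>
    have "u 0 = 0" using le_scale[of 2 0] le_scale[of "1/2" 0] by simp
    then show ?thesis using True by simp
  next
    case False
    then have c: "0 < c" using that by simp
    have "u (inverse c *\<^sub>R c *\<^sub>R x) \<le> inverse c * u (c *\<^sub>R x)"
      using c by (intro le_scale) simp
    then have "c * u x \<le> u (c *\<^sub>R x)" using c by (simp add: field_simps)
    with le_scale[OF c, of x] show ?thesis by simp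
  qed
  show ?thesis
    using sub hom by (simp add: sublinear_def u_def)
qed

text \<open>
  For fixed \<open>y\<close>, the functional \<open>v \<mapsto> inf {q (v + t y) - t q y | t \<ge> 0}\<close> is sublinear and at
  most \<open>q\<close>, so it equals \<open>q\<close>; the term \<open>t = 1\<close> then shows that \<open>q\<close> is superadditive.
\<close>

lemma minimal_sublinear_linear:
  fixes q :: "'b::real_vector \<Rightarrow> real"
  assumes q: "sublinear q"
    and minimal: "\<And>r. sublinear r \<Longrightarrow> (\<And>x. r x \<le> q x) \<Longrightarrow> r = q"
  shows "linear q"
proof -
  have super: "q x + q y \<le> q (x + y)" for x y
  proof -
    define R where "R v s \<longleftrightarrow> (\<exists>t\<ge>0. q (v + t *\<^sub>R y) - t * q y \<le> s)" for v s
    have lower: "- q (- v) \<le> s" if R: "R v s" for v s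
    proof -
      obtain t where t: "t \<ge> 0" "q (v + t *\<^sub>R y) - t * q y \<le> s"
        using R by (auto simp: R_def)
      have "q (t *\<^sub>R y) \<le> q (v + t *\<^sub>R y) + q (- v)"
        using sublinear_add[OF q, of "v + t *\<^sub>R y" "- v"] by simp
      with t show ?thesis by (simp add: sublinear_scale[OF q])
    qed
    have sub: "sublinear (\<lambda>v. Inf {s. R v s})"
    proof (rule sublinear_Inf[where b = "\<lambda>v. - q (- v)"])
      show "\<exists>s. R v s" for v by (auto simp: R_def)
      show "- q (- v) \<le> s" if "R v s" for v s using lower that .
      show "R (v + w) (s + t)" if R: "R v s" "R w t" for v w s t
      proof -
        obtain a b where a: "a \<ge> 0" "q (v + a *\<^sub>R y) - a * q y \<le> s"
          and b: "b \<ge> 0" "q (w + b *\<^sub>R y) - b * q y \<le> t"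
          using R by (auto simp: R_def)
        have "q ((v + w) + (a + b) *\<^sub>R y) \<le> q (v + a *\<^sub>R y) + q (w + b *\<^sub>R y)"
          using sublinear_add[OF q, of "v + a *\<^sub>R y" "w + b *\<^sub>R y"]
          by (simp add: algebra_simps)
        then show ?thesis
          unfolding R_def using a b by (intro exI[of _ "a + b"]) (simp add: algebra_simps)
      qed
      show "R (c *\<^sub>R v) (c * s)" if c: "0 < c" and R: "R v s" for c v s
      proof -
        obtain a where a: "a \<ge> 0" "q (v + a *\<^sub>R y) - a * q y \<le> s"
          using R by (auto simp: R_def)
        have "q (c *\<^sub>R v + (c * a) *\<^sub>R y) - (c * a) * q y = c * (q (v + a *\<^sub>R y) - a * q y)"
          using c sublinear_scale[OF q, of c "v + a *\<^sub>R y"] by (simp add: algebra_simps)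
        also have "\<dots> \<le> c * s" using a c by simp
        finally show ?thesis unfolding R_def using a c by (intro exI[of _ "c * a"]) simp
      qed
    qed
    have le: "Inf {s. R v s} \<le> s" if "R v s" for v s
      using that lower by (intro cInf_lower bdd_belowI[of _ "- q (- v)"]) auto
    have "(\<lambda>v. Inf {s. R v s}) = q"
      using sub by (rule minimal) (rule le, auto simp: R_def intro!: exI[of _ 0])
    moreover have "R x (q (x + y) - q y)"
      unfolding R_def by (intro exI[of _ 1]) simp
    ultimately have "q x \<le> q (x + y) - q y"
      using le by (auto simp: fun_eq_iff)
    then show ?thesis by simp
  qed
  then have add: "q (x + y) = q x + q y" for x y
    using sublinear_add[OF q] by (simp add: antisym)
  have neg: "q (- x) = - q x" for x
    using add[of x "- x"] sublinear_zero[OF q] by simp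
  show ?thesis
  proof (rule linearI)
    show "q (c *\<^sub>R x) = c *\<^sub>R q x" for c x
      using sublinear_scale[OF q, of c x] sublinear_scale[OF q, of "- c" x] neg[of "c *\<^sub>R x"]
      by (cases "0 \<le> c") auto
  qed (rule add)
qed

text \<open>Zorn's lemma for the reversed pointwise order yields a minimal sublinear functional
  below \<open>p\<close>, and minimal ones are linear. A chain is bounded by its pointwise
  infimum.\<close>

theorem exists_linear_le_sublinear:
  fixes p :: "'b::real_vector \<Rightarrow> real"
  assumes p: "sublinear p"
  shows "\<exists>F. linear F \<and> (\<forall>x. F x \<le> p x)"
proof -
  let ?S = "{q. sublinear q \<and> q \<le> p}"
  let ?P = "\<lambda>q r :: 'b \<Rightarrow> real. r \<le> q"
  have "\<exists>m\<in>?S. \<forall>a\<in>?S. ?P m a \<longrightarrow> a = m"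
  proof (rule predicate_Zorn)
    show "partial_order_on ?S (relation_of ?P ?S)"
      by (rule partial_order_on_relation_ofI) auto
  next
    fix C assume C: "C \<in> Chains (relation_of ?P ?S)"
    have CS: "C \<subseteq> ?S" and tot: "\<And>q r. q \<in> C \<Longrightarrow> r \<in> C \<Longrightarrow> q \<le> r \<or> r \<le> q"
      using C by (auto simp: Chains_def relation_of_def)
    show "\<exists>u\<in>?S. \<forall>a\<in>C. u \<le> a"
    proof (cases "C = {}")
      case True
      then show ?thesis using p by auto
    next
      case False
      then obtain q0 where q0: "q0 \<in> C" by blast
      define R where "R x s \<longleftrightarrow> (\<exists>q\<in>C. q x \<le> s)" for x s
      \<comment> \<open>The infimum is finite because
        \<open>- p (- x) \<le> - q (- x) \<le> q x\<close> for every \<open>q\<close> in the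
        chain.\<close>
      have lower: "- p (- x) \<le> s" if R: "R x s" for x s
      proof -
        obtain q where "q \<in> C" "q x \<le> s" using R by (auto simp: R_def)
        moreover have "sublinear q" "q (- x) \<le> p (- x)"
          using \<open>q \<in> C\<close> CS by (auto simp: le_fun_def)
        ultimately show ?thesis
          using sublinear_lower[of q x] by linarith
      qed
      let ?u = "\<lambda>x. Inf {s. R x s}"
      have "sublinear ?u"
      proof (rule sublinear_Inf[where b = "\<lambda>x. - p (- x)"])
        show "\<exists>s. R x s" for x using q0 by (auto simp: R_def)
        show "- p (- x) \<le> s" if "R x s" for x s using lower that .
        show "R (x + y) (s + t)" if R: "R x s" "R y t" for x y s t
        proof -
          obtain q r where q: "q \<in> C" "q x \<le> s" and r: "r \<in> C" "r y \<le> t"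
            using R by (auto simp: R_def)
          obtain m where m: "m \<in> C" "m \<le> q" "m \<le> r"
            using tot[OF q(1) r(1)] q(1) r(1) by blast
          then have "sublinear m" "m x \<le> q x" "m y \<le> r y"
            using CS by (auto simp: le_fun_def)
          then have "m (x + y) \<le> s + t"
            using sublinear_add[of m x y] q(2) r(2) by linarith
          with m show ?thesis by (auto simp: R_def)
        qed
        show "R (c *\<^sub>R x) (c * s)" if c: "0 < c" and R: "R x s" for c x s
        proof -
          obtain q where q: "q \<in> C" "q x \<le> s" using R by (auto simp: R_def)
          then have "q (c *\<^sub>R x) \<le> c * s"
            using CS c sublinear_scale[of q c x] by auto
          with q show ?thesis by (auto simp: R_def)
        qed
      qed
      moreover have le: "?u \<le> q" if "q \<in> C" for q
      proof (rule le_funI)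
        fix x
        have "R x (q x)" using that by (auto simp: R_def)
        then show "?u x \<le> q x"
          using lower by (intro cInf_lower bdd_belowI[of _ "- p (- x)"]) auto
      qed
      moreover have "?u \<le> p" using le[OF q0] q0 CS by (blast intro: order_trans)
      ultimately show ?thesis by (intro bexI[of _ ?u]) auto
    qed
  qed
  then obtain m where m: "sublinear m" "m \<le> p" "\<And>a. sublinear a \<Longrightarrow> a \<le> p \<Longrightarrow> a \<le> m \<Longrightarrow> a = m"
    by blast
  have "linear m"
    using m(1)
  proof (rule minimal_sublinear_linear)
    fix r assume "sublinear r" "\<And>x. r x \<le> m x"
    then show "r = m" using m by (intro m(3)) (auto simp: le_fun_def intro: order_trans)
  qed
  then show ?thesis using m(2) by (auto simp: le_fun_def)
qed

section \<open>Convex cones with algebraic interior points\<close>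

text \<open>Hahn-Banach is applied to \<open>inf {t. v + t k \<in> K}\<close>. Some \<open>t\<close>
  is admissible because \<open>k\<close> is an algebraic interior point, and the infimum is finite
  because a proper \<open>K\<close> cannot contain \<open>- k\<close>.\<close>

lemma exists_linear_neg_on_cone:
  fixes K :: "'b::real_vector set"
  assumes add: "\<And>x y. x \<in> K \<Longrightarrow> y \<in> K \<Longrightarrow> x + y \<in> K"
    and scale: "\<And>c x. 0 \<le> c \<Longrightarrow> x \<in> K \<Longrightarrow> c *\<^sub>R x \<in> K"
    and core: "\<And>v. \<exists>e>0. k + e *\<^sub>R v \<in> K"
    and k: "k \<in> K"
    and proper: "K \<noteq> UNIV"
  shows "\<exists>F. linear F \<and> (\<forall>x\<in>K. F x \<le> 0) \<and> F k < (0::real)"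
proof -
  have absorb: "\<exists>t>0. v + t *\<^sub>R k \<in> K" for v
  proof -
    obtain e where e: "e > 0" "k + e *\<^sub>R v \<in> K" using core by blast
    then have "inverse e *\<^sub>R (k + e *\<^sub>R v) \<in> K" by (intro scale) auto
    then show ?thesis using e(1)
      by (intro exI[of _ "inverse e"]) (simp add: scaleR_add_right add.commute)
  qed
  have neg: "- k \<notin> K"
  proof
    assume "- k \<in> K"
    have "v \<in> K" for v
    proof -
      obtain t where t: "t > 0" "v + t *\<^sub>R k \<in> K" using absorb by blast
      then have "v + t *\<^sub>R k + t *\<^sub>R (- k) \<in> K"
        using add[OF t(2) scale[OF _ \<open>- k \<in> K\<close>, of t]] by simp
      then show ?thesis by simp
    qed
    then show False using proper by blast
  qed
  \<comment> \<open>If \<open>- v + t k\<close> and \<open>v + s k\<close> lie in \<open>K\<close>,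
    so does \<open>(s + t) k\<close>; then \<open>s + t < 0\<close> would put \<open>- k\<close>
    into \<open>K\<close>. Hence \<open>- t\<close> is a lower bound.\<close>
  define b where "b v = - (SOME t. - v + t *\<^sub>R k \<in> K)" for v
  have lower: "b v \<le> s" if s: "v + s *\<^sub>R k \<in> K" for v s
  proof (rule ccontr)
    assume "\<not> b v \<le> s"
    have "- v + (- b v) *\<^sub>R k \<in> K"
      using someI_ex[of "\<lambda>t. - v + t *\<^sub>R k \<in> K"] absorb[of "- v"] unfolding b_def by auto
    then have "(v + s *\<^sub>R k) + (- v + (- b v) *\<^sub>R k) \<in> K" using s add by blast
    then have "(s - b v) *\<^sub>R k \<in> K" by (simp add: algebra_simps)
    then have "inverse (b v - s) *\<^sub>R (s - b v) *\<^sub>R k \<in> K"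
      using \<open>\<not> b v \<le> s\<close> by (intro scale[of "inverse (b v - s)"]) simp_all
    then have "(inverse (b v - s) * (s - b v)) *\<^sub>R k \<in> K"
      by (simp only: scaleR_scaleR)
    moreover have "inverse (b v - s) * (s - b v) = -1"
      using \<open>\<not> b v \<le> s\<close> by (simp add: field_simps)
    ultimately show False using neg by simp
  qed
  \<comment> \<open>A linear functional below this one is nonpositive on \<open>K\<close> and at most \<open>-1\<close> at \<open>k\<close>.\<close>
  let ?p = "\<lambda>v. Inf {t. v + t *\<^sub>R k \<in> K}"
  have "sublinear ?p"
  proof (rule sublinear_Inf[where b = b])
    show "\<exists>s. v + s *\<^sub>R k \<in> K" for v using absorb by blast
    show "b v \<le> s" if "v + s *\<^sub>R k \<in> K" for v s using lower that .
    show "x + y + (s + t) *\<^sub>R k \<in> K" if "x + s *\<^sub>R k \<in> K" "y + t *\<^sub>R k \<in> K" for x y s t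
      using add[OF that] by (simp add: algebra_simps)
    show "c *\<^sub>R x + (c * s) *\<^sub>R k \<in> K" if "0 < c" "x + s *\<^sub>R k \<in> K" for c x s
      using scale[of c "x + s *\<^sub>R k"] that by (simp add: scaleR_add_right)
  qed
  then obtain F where F: "linear F" "\<And>v. F v \<le> ?p v"
    using exists_linear_le_sublinear by blast
  have le: "F v \<le> s" if "v + s *\<^sub>R k \<in> K" for v s
    using that lower by (intro order_trans[OF F(2)] cInf_lower bdd_belowI[of _ "b v"]) auto
  have "F k \<le> -1"
    using scale[of 0 k] k by (intro le) simp
  moreover have "F x \<le> 0" if "x \<in> K" for x
    using that by (intro le) simp
  ultimately show ?thesis using F(1) by (intro exI[of _ F]) auto
qed

text \<open>Steinitz exchange: when \<open>b\<close> cannot be dropped, some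
  \<open>c \<in> S\<close> outside \<open>span (M \<union> B)\<close> takes its place.\<close>

lemma finite_spanning_subset:
  fixes M B S :: "'b::real_vector set"
  assumes "finite B" "S \<subseteq> span (M \<union> B)"
  shows "\<exists>T. finite T \<and> T \<subseteq> S \<and> S \<subseteq> span (M \<union> T)"
  using assms
proof (induction B arbitrary: M rule: finite_induct)
  case empty
  then show ?case by (intro exI[of _ "{}"]) auto
next
  case (insert b B)
  show ?case
  proof (cases "S \<subseteq> span (M \<union> B)")
    case True
    then show ?thesis using insert.IH by blast
  next
    case False
    then obtain c where c: "c \<in> S" "c \<notin> span (M \<union> B)" by blast
    have "c \<in> span (insert b (M \<union> B))"
      using c(1) insert.prems by auto
    then have "b \<in> span (insert c (M \<union> B))"
      using c(2) by (rule in_span_insert)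
    then have "insert b (M \<union> B) \<subseteq> span (insert c M \<union> B)"
      by (auto intro: span_base)
    then have "span (insert b (M \<union> B)) \<subseteq> span (insert c M \<union> B)"
      by (simp add: span_minimal)
    then have "S \<subseteq> span (insert c M \<union> B)"
      using insert.prems by auto
    then obtain T where "finite T" "T \<subseteq> S" "S \<subseteq> span (insert c M \<union> T)"
      using insert.IH[of "insert c M"] by auto
    then show ?thesis using c(1) by (intro exI[of _ "insert c T"]) simp
  qed
qed

text \<open>Adding a generator \<open>c \<in> K\<close> to \<open>k\<close> makes room in both
  directions along \<open>c\<close>, so \<open>k + c\<close> is an algebraic interior point relative
  to the span enlarged by \<open>c\<close>.\<close>

lemma cone_core_extend:
  fixes K M T :: "'b::real_vector set"
  assumes add: "\<And>x y. x \<in> K \<Longrightarrow> y \<in> K \<Longrightarrow> x + y \<in> K"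
    and scale: "\<And>c x. 0 \<le> c \<Longrightarrow> x \<in> K \<Longrightarrow> c *\<^sub>R x \<in> K"
    and "finite T" "T \<subseteq> K" "k \<in> K"
    and "\<And>v. v \<in> span M \<Longrightarrow> \<exists>e>0. k + e *\<^sub>R v \<in> K"
  shows "\<exists>k'\<in>K. \<forall>v\<in>span (M \<union> T). \<exists>e>0. k' + e *\<^sub>R v \<in> K"
  using assms(3-)
proof (induction T arbitrary: M k rule: finite_induct)
  case empty
  then show ?case by auto
next
  case (insert c T)
  have c: "c \<in> K" using insert.prems by simp
  have core: "\<exists>e>0. (k + c) + e *\<^sub>R v \<in> K" if v: "v \<in> span (insert c M)" for v
  proof -
    obtain b where b: "v - b *\<^sub>R c \<in> span M"
      using v by (auto simp: span_breakdown_eq)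
    obtain e where e: "e > 0" "k + e *\<^sub>R (v - b *\<^sub>R c) \<in> K"
      using insert.prems(3)[OF b] by blast
    \<comment> \<open>The two bounds make \<open>1 - d / e\<close> and \<open>1 + d b\<close>
      nonnegative, the weights of \<open>k\<close> and \<open>c\<close> in the conic combination
      below.\<close>
    define d where "d = min e (inverse (1 + \<bar>b\<bar>))"
    have d: "0 < d" "d \<le> e" "0 \<le> 1 + d * b"
    proof -
      have "d * \<bar>b\<bar> \<le> inverse (1 + \<bar>b\<bar>) * \<bar>b\<bar>"
        by (intro mult_right_mono) (auto simp: d_def)
      also have "\<dots> \<le> 1" by (simp add: field_simps)
      finally have "d * \<bar>b\<bar> \<le> 1" .
      moreover show "0 < d" "d \<le> e" using e by (auto simp: d_def)
      ultimately have "\<bar>d * b\<bar> \<le> 1" by (simp add: abs_mult)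
      then show "0 \<le> 1 + d * b" by linarith
    qed
    have "(1 - d / e) *\<^sub>R k + (d / e) *\<^sub>R (k + e *\<^sub>R (v - b *\<^sub>R c)) + (1 + d * b) *\<^sub>R c \<in> K"
      using d e(1) by (intro add scale insert.prems(2) e(2) c) auto
    also have "(1 - d / e) *\<^sub>R k + (d / e) *\<^sub>R (k + e *\<^sub>R (v - b *\<^sub>R c)) + (1 + d * b) *\<^sub>R c
        = (k + c) + d *\<^sub>R v"
      using e(1) by (simp add: algebra_simps)
    finally show ?thesis using d(1) by blast
  qed
  have "\<exists>k'\<in>K. \<forall>v\<in>span (insert c M \<union> T). \<exists>e>0. k' + e *\<^sub>R v \<in> K"
    using insert.prems c add core by (intro insert.IH[of "k + c" "insert c M"]) auto
  then show ?case by simp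
qed

section \<open>The Mackey topology\<close>

lemma pairing_zero [simp]: "pairing 0 x = 0"
  and pairing_plus [simp]: "pairing (f + g) x = pairing f x + pairing g x"
  and pairing_uminus [simp]: "pairing (- f) x = - pairing f x"
  and pairing_minus [simp]: "pairing (f - g) x = pairing f x - pairing g x"
  and pairing_scaleR_left [simp]: "pairing (c *\<^sub>R f) x = c * pairing f x"
  by (transfer; simp)+

lemma linear_pairing: "linear (pairing f)"
  using pairing[of f] by simp

lemma pairing_right_zero [simp]: "pairing f 0 = 0"
  and pairing_right_add [simp]: "pairing f (x + y) = pairing f x + pairing f y"
  and pairing_right_scaleR [simp]: "pairing f (c *\<^sub>R x) = c * pairing f x"
  and pairing_right_diff [simp]: "pairing f (x - y) = pairing f x - pairing f y"
  using linear_0[OF linear_pairing] linear_diff[OF linear_pairing] linear_add[OF linear_pairing] linear_scale[OF linear_pairing]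
  by auto

lemma pairing_sum: "pairing (sum f J) x = (\<Sum>j\<in>J. pairing (f j) x)"
  by (induction J rule: infinite_finite_induct) auto

lemma topspace_weak_topology [simp]: "topspace weak_topology = UNIV"
  by (auto simp: weak_topology_def topspace_pullback_topology)

lemma continuous_map_into_weak_topology:
  "continuous_map T weak_topology h \<longleftrightarrow> (\<forall>f. continuous_map T euclideanreal (\<lambda>x. pairing f (h x)))"
proof
  assume h: "continuous_map T weak_topology h"
  have "continuous_map weak_topology (powertop_real UNIV) ((\<lambda>z. z) \<circ> (\<lambda>x f. pairing f x))"
    unfolding weak_topology_def by (rule continuous_map_pullback) simp
  from continuous_map_compose[OF h this]
  show "\<forall>f. continuous_map T euclideanreal (\<lambda>x. pairing f (h x))"
    by (simp add: continuous_map_componentwise_UNIV o_def)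
next
  assume "\<forall>f. continuous_map T euclideanreal (\<lambda>x. pairing f (h x))"
  then show "continuous_map T weak_topology h"
    unfolding weak_topology_def
    by (intro continuous_map_pullback') (auto simp: continuous_map_componentwise_UNIV o_def)
qed

lemma continuous_map_pairing: "continuous_map weak_topology euclideanreal (pairing f)"
  using continuous_map_into_weak_topology[of weak_topology "\<lambda>x. x"] by auto

lemma topspace_weak_star_topology [simp]: "topspace weak_star_topology = UNIV"
  by (auto simp: weak_star_topology_def topspace_pullback_topology)

lemma continuous_map_weak_star_eval:
  "continuous_map weak_star_topology euclideanreal (\<lambda>f. pairing f x)"
proof -
  have "continuous_map (pullback_topology UNIV pairing (powertop_real UNIV)) euclideanreal
      ((\<lambda>z. z x) \<circ> pairing)"
    by (intro continuous_map_pullback continuous_map_product_projection) simp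
  then show ?thesis by (simp add: weak_star_topology_def o_def)
qed

section \<open>Weakly compact disks and Mackey neighbourhoods\<close>

text \<open>The sets that define the Mackey topology, with the empty set excluded through
  \<open>0 \<in> K\<close> so that maxima over \<open>K\<close> exist.\<close>

definition weak_disk :: "'a::locally_convex_t2_space set \<Rightarrow> bool" where
  "weak_disk K \<longleftrightarrow> compactin weak_topology K \<and> convex K \<and>
     (\<forall>c x. \<bar>c\<bar> \<le> 1 \<longrightarrow> x \<in> K \<longrightarrow> c *\<^sub>R x \<in> K) \<and> 0 \<in> K"

lemma weak_disk_insert_0:
  assumes "compactin weak_topology K" "convex K" "\<And>c x. \<bar>c\<bar> \<le> 1 \<Longrightarrow> x \<in> K \<Longrightarrow> c *\<^sub>R x \<in> K"
  shows "weak_disk (insert 0 K)"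
proof (cases "K = {}")
  case True
  then show ?thesis by (simp add: weak_disk_def)
next
  case False
  then obtain x where "x \<in> K" by blast
  then have "0 \<in> K" using assms(3)[of 0 x] by simp
  then show ?thesis using assms by (simp add: weak_disk_def insert_absorb)
qed

text \<open>Sums make the disks directed: \<open>K + L\<close> contains \<open>K\<close> and
  \<open>L\<close>, so one disk controls an intersection of two basic neighbourhoods.\<close>

lemma weak_disk_add:
  assumes K: "weak_disk K" and L: "weak_disk L"
  shows "weak_disk ((\<lambda>(x, y). x + y) ` (K \<times> L))"
proof -
  have "continuous_map (prod_topology weak_topology weak_topology) weak_topology (\<lambda>(x :: 'a, y). x + y)"
    unfolding continuous_map_into_weak_topology case_prod_unfold pairing_right_add
    using continuous_map_compose[OF continuous_map_fst continuous_map_pairing]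
      continuous_map_compose[OF continuous_map_snd continuous_map_pairing]
    by (intro allI continuous_map_add) (auto simp: o_def)
  then have "compactin weak_topology ((\<lambda>(x, y). x + y) ` (K \<times> L))"
    using K L by (intro image_compactin) (auto simp: weak_disk_def compactin_Times)
  moreover have "convex ((\<lambda>(x, y). x + y) ` (K \<times> L))"
  proof -
    have "linear (\<lambda>(x :: 'a, y). x + y)"
      by (auto simp: linear_iff algebra_simps)
    then show ?thesis
      using K L by (intro convex_linear_image convex_Times) (auto simp: weak_disk_def)
  qed
  moreover have "c *\<^sub>R z \<in> (\<lambda>(x, y). x + y) ` (K \<times> L)"
    if c: "\<bar>c\<bar> \<le> 1" and z: "z \<in> (\<lambda>(x, y). x + y) ` (K \<times> L)" for c z
  proof -
    obtain x y where "x \<in> K" "y \<in> L" "z = x + y" using z by auto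
    then show ?thesis
      using K L c by (auto simp: weak_disk_def scaleR_add_right intro!: rev_image_eqI[of "(c *\<^sub>R x, c *\<^sub>R y)"])
  qed
  moreover have "0 \<in> (\<lambda>(x, y). x + y) ` (K \<times> L)"
    using K L by (force simp: weak_disk_def)
  ultimately show ?thesis by (simp add: weak_disk_def)
qed

text \<open>Weak compactness gives a maximum of \<open>pairing f\<close> on \<open>K\<close>, and
  balancedness turns it into a bound for the absolute value.\<close>

lemma weak_disk_attains_bound:
  assumes K: "weak_disk K"
  shows "\<exists>y\<in>K. \<forall>x\<in>K. \<bar>pairing f x\<bar> \<le> pairing f y"
proof -
  have "compact (pairing f ` K)"
    using image_compactin[OF _ continuous_map_pairing, of K f] K by (simp add: weak_disk_def)
  moreover have "pairing f ` K \<noteq> {}" using K by (auto simp: weak_disk_def)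
  ultimately obtain y where y: "y \<in> K" "\<And>x. x \<in> K \<Longrightarrow> pairing f x \<le> pairing f y"
    using compact_attains_sup[of "pairing f ` K"] by fastforce
  have "\<bar>pairing f x\<bar> \<le> pairing f y" if x: "x \<in> K" for x
  proof -
    have "\<forall>c. \<bar>c\<bar> \<le> 1 \<longrightarrow> c *\<^sub>R x \<in> K"
      using K x unfolding weak_disk_def by blast
    then have "(-1) *\<^sub>R x \<in> K" by (elim allE[of _ "-1"]) simp
    from y(2)[OF this] y(2)[OF x] show ?thesis
      unfolding pairing_right_scaleR by linarith
  qed
  with y(1) show ?thesis by blast
qed

text \<open>The generating balls have arbitrary centres and form a subbase. Intersections are
  handled by adding disks; a ball is recentred at \<open>f\<close> by the triangle
  inequality.\<close>

lemma mackey_basic_nbhd: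
  assumes "openin mackey_topology V" "f \<in> V"
  shows "\<exists>K e. weak_disk K \<and> 0 < e \<and> {g. \<forall>x\<in>K. \<bar>pairing g x - pairing f x\<bar> < e} \<subseteq> V"
  using assms unfolding mackey_topology_def openin_topology_generated_by_iff
proof (induction V rule: generate_topology_on.induct)
  case Empty
  then show ?case by simp
next
  case (Int a b)
  obtain K d where K: "weak_disk K" "0 < d" "{g. \<forall>x\<in>K. \<bar>pairing g x - pairing f x\<bar> < d} \<subseteq> a"
    using Int by blast
  obtain L e where L: "weak_disk L" "0 < e" "{g. \<forall>x\<in>L. \<bar>pairing g x - pairing f x\<bar> < e} \<subseteq> b"
    using Int by blast
  let ?S = "(\<lambda>(x, y). x + y) ` (K \<times> L)"
  have sub: "K \<subseteq> ?S" "L \<subseteq> ?S"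
  proof -
    show "K \<subseteq> ?S"
      using L(1) by (auto simp: weak_disk_def intro!: rev_image_eqI[of "(_, 0)"])
    show "L \<subseteq> ?S"
      using K(1) by (auto simp: weak_disk_def intro!: rev_image_eqI[of "(0, _)"])
  qed
  have "{g. \<forall>x\<in>?S. \<bar>pairing g x - pairing f x\<bar> < min d e} \<subseteq> a \<inter> b"
  proof
    fix g assume g: "g \<in> {g. \<forall>x\<in>?S. \<bar>pairing g x - pairing f x\<bar> < min d e}"
    then have "\<And>x. x \<in> ?S \<Longrightarrow> \<bar>pairing g x - pairing f x\<bar> < min d e" by blast
    then have "\<And>x. x \<in> ?S \<Longrightarrow> \<bar>pairing g x - pairing f x\<bar> < d \<and> \<bar>pairing g x - pairing f x\<bar> < e"
      by (simp only: min_less_iff_conj)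
    then have "\<forall>x\<in>K. \<bar>pairing g x - pairing f x\<bar> < d" "\<forall>x\<in>L. \<bar>pairing g x - pairing f x\<bar> < e"
      using sub by (simp_all only: subset_iff) blast+
    then show "g \<in> a \<inter> b" using K(3) L(3) by blast
  qed
  then show ?case
    using weak_disk_add[OF K(1) L(1)] K(2) L(2)
    by (intro exI[of _ ?S] exI[of _ "min d e"]) auto
next
  case (UN F)
  then obtain k where "k \<in> F" "f \<in> k" by blast
  then show ?case using UN.IH[of k] by blast
next
  case (Basis s)
  obtain h K e where s: "s = {g. \<forall>x\<in>K. \<bar>pairing g x - pairing h x\<bar> < e}" "0 < e"
    and K: "compactin weak_topology K" "convex K" "\<And>c x. \<bar>c\<bar> \<le> 1 \<Longrightarrow> x \<in> K \<Longrightarrow> c *\<^sub>R x \<in> K"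
    using Basis.hyps by blast
  let ?K = "insert 0 K"
  have disk: "weak_disk ?K" using K by (rule weak_disk_insert_0)
  have f: "\<bar>pairing (f - h) x\<bar> < e" if "x \<in> ?K" for x
    using that Basis.prems s by auto
  obtain y where y: "y \<in> ?K" "\<forall>x\<in>?K. \<bar>pairing (f - h) x\<bar> \<le> pairing (f - h) y"
    using weak_disk_attains_bound[OF disk, of "f - h"] by (rule bexE)
  \<comment> \<open>The new radius is what the distance from \<open>f\<close> to the old centre
    \<open>h\<close> leaves over; it is positive because the maximum is attained at
    \<open>y\<close>.\<close>
  have "{g. \<forall>x\<in>?K. \<bar>pairing g x - pairing f x\<bar> < e - pairing (f - h) y} \<subseteq> s"
    unfolding s(1)
  proof (intro subsetI CollectI ballI)
    fix g x
    assume g: "g \<in> {g. \<forall>x\<in>?K. \<bar>pairing g x - pairing f x\<bar> < e - pairing (f - h) y}" and x: "x \<in> K"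
    have "\<bar>pairing g x - pairing f x\<bar> < e - pairing (f - h) y" using g x by blast
    moreover have "\<bar>pairing f x - pairing h x\<bar> \<le> pairing (f - h) y"
      using bspec[OF y(2), of x] x by simp
    ultimately show "\<bar>pairing g x - pairing h x\<bar> < e" by linarith
  qed
  moreover have "0 < e - pairing (f - h) y" using f[OF y(1)] by linarith
  ultimately show ?case using disk by blast
qed

lemma topspace_mackey_topology [simp]: "topspace mackey_topology = UNIV"
proof -
  have "UNIV \<in> {{g. \<forall>x\<in>K. \<bar>pairing g x - pairing f x\<bar> < e} | f K e.
        0 < e \<and> compactin weak_topology K \<and> convex K \<and>
        (\<forall>c x. \<bar>c\<bar> \<le> 1 \<longrightarrow> x \<in> K \<longrightarrow> c *\<^sub>R x \<in> K)}"
    \<comment> \<open>The empty set gives a ball without any condition, which is the whole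
      dual.\<close>
    by (intro CollectI exI[of _ 0] exI[of _ "{}"] exI[of _ 1]) auto
  then show ?thesis
    unfolding mackey_topology_def topology_generated_by_topspace by blast
qed

section \<open>Functionals represented by points of \<open>X\<close> (Mackey-Arens)\<close>

lemma compact_hyperplane_slice:
  assumes "compactin weak_topology K"
  shows "compactin weak_topology {x \<in> K. pairing g x = c}"
proof -
  have "closedin weak_topology {x \<in> topspace weak_topology. pairing g x \<in> {c}}"
    by (rule closedin_continuous_map_preimage[OF continuous_map_pairing]) simp
  then have "compactin weak_topology ({x. pairing g x = c} \<inter> K)"
    using assms by (intro closed_Int_compactin) auto
  then show ?thesis by (simp add: Int_def conj_commute)
qed

text \<open>If \<open>(F h, F g)\<close> missed the compact convex image of \<open>K\<close> in the
  plane, a separating line would give a combination \<open>r\<close> of \<open>h\<close> and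
  \<open>g\<close> with \<open>F r > pairing r x\<close> on all of \<open>K\<close>, against
  domination.\<close>

lemma dominated_functional_slice:
  fixes F :: "'a::locally_convex_t2_space dual \<Rightarrow> real"
  assumes F: "linear F" and S: "subspace S"
    and K: "compactin weak_topology K" "convex K"
    and dom: "\<And>g. g \<in> S \<Longrightarrow> \<exists>x\<in>K. F g \<le> pairing g x"
    and h: "h \<in> S" and g: "g \<in> S"
  shows "\<exists>x\<in>K. pairing h x = F h \<and> F g = pairing g x"
proof (rule ccontr)
  assume contra: "\<not> ?thesis"
  let ?P = "\<lambda>x. (pairing h x, pairing g x)"
  have "linear ?P" by (simp add: linear_iff)
  then have conv: "convex (?P ` K)" using K(2) by (rule convex_linear_image)
  have "continuous_map weak_topology (prod_topology euclideanreal euclideanreal) ?P"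
    by (intro continuous_map_pairedI continuous_map_pairing)
  then have "compact (?P ` K)"
    using image_compactin[OF K(1)] by (simp add: euclidean_product_topology flip: compactin_euclidean_iff)
  then have "closed (?P ` K)" by (rule compact_imp_closed)
  moreover have "(F h, F g) \<notin> ?P ` K" using contra by auto
  ultimately obtain a b where a: "inner a (F h, F g) < b" "\<forall>z\<in>?P ` K. inner a z > b"
    using separating_hyperplane_closed_point[OF conv] by blast
  define r where "r = - (fst a *\<^sub>R h + snd a *\<^sub>R g)"
  have "r \<in> S"
    unfolding r_def using S h g by (intro subspace_neg subspace_add subspace_scale)
  then obtain x where x: "x \<in> K" "F r \<le> pairing r x" using dom by blast
  have "F r = - inner a (F h, F g)"
    unfolding r_def by (simp add: linear_neg[OF F] linear_add[OF F] linear_diff[OF F] linear_scale[OF F] inner_prod_def)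
  moreover have "pairing r x = - inner a (?P x)"
    by (simp add: r_def inner_prod_def)
  ultimately show False using a x by force
qed

text \<open>
  Separation in the plane shows that domination survives cutting \<open>K\<close> down to finitely many
  of the hyperplanes \<open>{x. pairing g x = F g}\<close>; compactness of \<open>K\<close> then yields a point in all
  of them. No extension of \<open>F\<close> from \<open>S\<close> is needed.
\<close>

theorem dominated_functional_represented:
  fixes F :: "'a::locally_convex_t2_space dual \<Rightarrow> real"
  assumes F: "linear F" and S: "subspace S"
    and K: "compactin weak_topology K" "convex K"
    and dom: "\<And>g. g \<in> S \<Longrightarrow> \<exists>x\<in>K. F g \<le> pairing g x"
  shows "\<exists>x\<in>K. \<forall>g\<in>S. F g = pairing g x"
proof -
  let ?slice = "\<lambda>G. {x \<in> K. \<forall>g\<in>G. pairing g x = F g}"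
  have fin: "compactin weak_topology (?slice G) \<and> convex (?slice G) \<and>
      (\<forall>g\<in>S. \<exists>x\<in>?slice G. F g \<le> pairing g x)" if "finite G" "G \<subseteq> S" for G
    using that
  proof (induction G rule: finite_induct)
    case empty
    then show ?case using K dom by simp
  next
    case (insert h G)
    have eq: "?slice (insert h G) = {x \<in> ?slice G. pairing h x = F h}" by auto
    have "convex {x. pairing h x = F h}"
      unfolding convex_def by (auto simp: algebra_simps simp flip: distrib_right)
    then have "convex ({x. pairing h x = F h} \<inter> ?slice G)"
      using insert by (intro convex_Int) auto
    moreover have "{x. pairing h x = F h} \<inter> ?slice G = ?slice (insert h G)" by auto
    ultimately have "convex (?slice (insert h G))" by simp
    moreover have "compactin weak_topology (?slice (insert h G))"
      unfolding eq using insert by (intro compact_hyperplane_slice) auto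
    moreover have "\<exists>x\<in>?slice (insert h G). F g \<le> pairing g x" if "g \<in> S" for g
    proof -
      have "\<exists>x\<in>?slice G. pairing h x = F h \<and> F g = pairing g x"
        using insert that by (intro dominated_functional_slice[OF F S]) auto
      then show ?thesis by auto
    qed
    ultimately show ?case by blast
  qed
  let ?U = "(\<lambda>g. {x. pairing g x = F g}) ` S"
  have closed: "closedin weak_topology {x. pairing g x = F g}" for g
    using closedin_continuous_map_preimage[OF continuous_map_pairing, of "{F g}" g] by simp
  have "K \<inter> \<Inter>?U \<noteq> {}"
  proof -
    have "K \<inter> \<Inter>\<F> \<noteq> {}" if \<F>: "finite \<F>" "\<F> \<subseteq> ?U" for \<F>
    proof -
      obtain G where G: "finite G" "G \<subseteq> S" "\<F> = (\<lambda>g. {x. pairing g x = F g}) ` G"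
        using finite_subset_image[OF \<F>] by blast
      \<comment> \<open>For the zero functional, domination says only that the slice is
        nonempty.\<close>
      have "\<exists>x\<in>?slice G. F 0 \<le> pairing 0 x"
        using fin[OF G(1,2)] subspace_0[OF S] by blast
      then show ?thesis using G(3) by auto
    qed
    moreover have "\<forall>C\<in>?U. closedin weak_topology C" using closed by blast
    ultimately show ?thesis
      using K(1)[unfolded compactin_fip, THEN conjunct2, rule_format, of ?U] by blast
  qed
  then obtain x where "x \<in> K" "\<forall>g\<in>S. pairing g x = F g" by blast
  then show ?thesis by (intro bexI[of _ x]) auto
qed

text \<open>By homogeneity, a bound on the Mackey ball within \<open>S\<close> makes the support
  function of the scaled disk \<open>(d / e) K\<close> dominate \<open>F\<close> on
  \<open>S\<close>.\<close>

lemma mackey_bounded_functional_represented: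
  fixes F :: "'a::locally_convex_t2_space dual \<Rightarrow> real"
  assumes F: "linear F" and S: "subspace S" and K: "weak_disk K" and e: "0 < e"
    and bound: "\<And>g. g \<in> S \<Longrightarrow> (\<And>x. x \<in> K \<Longrightarrow> \<bar>pairing g x\<bar> < e) \<Longrightarrow> F g \<le> c"
  shows "\<exists>x. \<forall>g\<in>S. F g = pairing g x"
proof -
  have "F 0 \<le> c" using S e by (intro bound) (auto simp: subspace_0)
  then have c: "0 \<le> c" by (simp add: linear_0[OF F])
  define d where "d = c + 1"
  have d: "0 < d" "c \<le> d" using c by (auto simp: d_def)
  let ?K = "(\<lambda>x. (d / e) *\<^sub>R x) ` K"
  have "continuous_map weak_topology weak_topology (\<lambda>x :: 'a. (d / e) *\<^sub>R x)"
    unfolding continuous_map_into_weak_topology pairing_right_scaleR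
    by (intro allI continuous_map_real_mult_left continuous_map_pairing)
  then have "compactin weak_topology ?K"
    using K by (intro image_compactin) (auto simp: weak_disk_def)
  moreover have "convex ?K"
    using K by (intro convex_scaling) (simp add: weak_disk_def)
  moreover have "\<exists>x\<in>?K. F g \<le> pairing g x" if g: "g \<in> S" for g
  proof -
    obtain y where y: "y \<in> K" "\<forall>x\<in>K. \<bar>pairing g x\<bar> \<le> pairing g y"
      using weak_disk_attains_bound[OF K, of g] by (rule bexE)
    have m: "0 \<le> pairing g y" using y by fastforce
    have "F g \<le> d / e * pairing g y + h" if h: "0 < h" for h
    proof -
      \<comment> \<open>The strict ball needs a scale above \<open>pairing g y / e\<close>, which
        may be \<open>0\<close>; the excess \<open>h / d\<close> costs exactly \<open>h\<close>
        after multiplication by \<open>d\<close>.\<close>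
      define s where "s = pairing g y / e + h / d"
      have s: "0 < s" "pairing g y < e * s"
      proof -
        show "0 < s" using m e h d by (simp add: s_def add_nonneg_pos)
        have "0 < e * (h / d)" using e h d by simp
        then show "pairing g y < e * s" using e by (simp add: s_def distrib_left)
      qed
      have "F (inverse s *\<^sub>R g) \<le> c"
      proof (rule bound)
        show "inverse s *\<^sub>R g \<in> S" using S g by (rule subspace_scale)
        fix x assume "x \<in> K"
        then have "\<bar>pairing g x\<bar> < e * s" using y(2) s(2) by fastforce
        then show "\<bar>pairing (inverse s *\<^sub>R g) x\<bar> < e"
          using s(1) by (simp add: abs_mult field_simps)
      qed
      then have "F g \<le> c * s"
        using s(1) by (simp add: linear_scale[OF F] field_simps)
      also have "\<dots> \<le> d * s" using d s by simp
      also have "\<dots> = d / e * pairing g y + h"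
        using d(1) by (simp add: s_def algebra_simps)
      finally show ?thesis .
    qed
    then have "F g \<le> pairing g ((d / e) *\<^sub>R y)"
      unfolding pairing_right_scaleR by (rule field_le_epsilon)
    then show ?thesis using y(1) by blast
  qed
  ultimately have "\<exists>x\<in>?K. \<forall>g\<in>S. F g = pairing g x"
    by (rule dominated_functional_represented[OF F S])
  then show ?thesis by blast
qed

section \<open>Annihilators and extensions by finitely many vectors\<close>

lemma subspace_linear_projection:
  fixes S :: "'b::real_vector set"
  assumes "subspace S"
  shows "\<exists>\<pi>. linear \<pi> \<and> range \<pi> \<subseteq> S \<and> (\<forall>v\<in>S. \<pi> v = v)"
  using linear_exists_left_inverse_on[OF linear_id assms] by auto

lemma exists_linear_vanishing_on_subspace:
  fixes M :: "'b::real_vector set"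
  assumes M: "subspace M" and b: "b \<notin> M"
  shows "\<exists>F :: 'b \<Rightarrow> real. linear F \<and> (\<forall>m\<in>M. F m = 0) \<and> F b = 1"
proof -
  obtain \<pi> where \<pi>: "linear \<pi>" "range \<pi> \<subseteq> M" "\<And>v. v \<in> M \<Longrightarrow> \<pi> v = v"
    using subspace_linear_projection[OF M] by blast
  have "b - \<pi> b \<noteq> 0" using \<pi>(2) b by (metis eq_iff_diff_eq_0 rangeI subsetD)
  then have "independent {b - \<pi> b}" by simp
  then obtain G :: "'b \<Rightarrow> real" where G: "linear G" "\<forall>x\<in>{b - \<pi> b}. G x = 1"
    using linear_independent_extend[of "{b - \<pi> b}" "\<lambda>_. 1"] by blast
  have "linear (\<lambda>v. G (v - \<pi> v))"
    using linear_compose[OF linear_compose_sub[OF linear_id \<pi>(1)] G(1)] by (simp add: o_def)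
  then show ?thesis
    using G \<pi>(3) by (intro exI[of _ "\<lambda>v. G (v - \<pi> v)"]) (auto simp: linear_0)
qed

text \<open>For a subspace this says that \<open>M\<close> is the annihilator of its annihilator in
  \<open>X\<close>, which is weak-star closedness.\<close>

definition annihilator_separated :: "'a::locally_convex_t2_space dual set \<Rightarrow> bool" where
  "annihilator_separated M \<longleftrightarrow>
     (\<forall>b. b \<notin> M \<longrightarrow> (\<exists>x. (\<forall>m\<in>M. pairing m x = 0) \<and> pairing b x = 1))"

text \<open>A functional that vanishes on \<open>M\<close> and is 1 at \<open>b\<close> is bounded
  on a Mackey ball of \<open>span (insert b M)\<close>, because \<open>b\<close> has a Mackey
  neighbourhood missing \<open>M\<close>. Hence a point of \<open>X\<close> represents it.\<close>

lemma mackey_closed_annihilator_separated: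
  assumes M: "subspace M" and closed: "closedin mackey_topology M"
  shows "annihilator_separated M"
  unfolding annihilator_separated_def
proof (intro allI impI)
  fix b assume b: "b \<notin> M"
  have "openin mackey_topology (UNIV - M)"
    using closed by (simp add: closedin_def)
  then obtain K e where K: "weak_disk K" and e: "0 < e"
    and V: "{g. \<forall>x\<in>K. \<bar>pairing g x - pairing b x\<bar> < e} \<subseteq> UNIV - M"
    using mackey_basic_nbhd[of "UNIV - M" b] b by blast
  obtain F :: "'a dual \<Rightarrow> real" where F: "linear F" "\<And>m. m \<in> M \<Longrightarrow> F m = 0" "F b = 1"
    using exists_linear_vanishing_on_subspace[OF M b] by blast
  have "\<exists>x. \<forall>g\<in>span (insert b M). F g = pairing g x"
  proof (rule mackey_bounded_functional_represented[OF F(1) subspace_span K e])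
    fix g assume g: "g \<in> span (insert b M)" and small: "\<And>x. x \<in> K \<Longrightarrow> \<bar>pairing g x\<bar> < e"
    obtain t where t: "g - t *\<^sub>R b \<in> M"
      using g M by (auto simp: span_breakdown_eq span_eq_iff[THEN iffD2])
    have Fg: "F g = t"
      using F(2)[OF t] F(3) by (simp add: linear_diff[OF F(1)] linear_scale[OF F(1)])
    \<comment> \<open>If \<open>F g = t > 1\<close>, then \<open>b - g / t\<close> lies in
      \<open>M\<close> and yet in the neighbourhood of \<open>b\<close>.\<close>
    show "F g \<le> 1"
    proof (rule ccontr)
      assume "\<not> F g \<le> 1"
      then have t1: "1 < t" using Fg by simp
      have "(- inverse t) *\<^sub>R (g - t *\<^sub>R b) \<in> M"
        using M t by (rule subspace_scale)
      moreover have "(- inverse t) *\<^sub>R (g - t *\<^sub>R b) = b - inverse t *\<^sub>R g"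
        using t1 by (simp add: algebra_simps)
      moreover have "\<bar>pairing (b - inverse t *\<^sub>R g) x - pairing b x\<bar> < e" if "x \<in> K" for x
      proof -
        have "inverse t * \<bar>pairing g x\<bar> \<le> 1 * \<bar>pairing g x\<bar>"
          using t1 by (intro mult_right_mono) (auto simp: field_simps)
        then show ?thesis using small[OF that] t1 by (simp add: abs_mult)
      qed
      ultimately have "b - inverse t *\<^sub>R g \<in> M"
        "b - inverse t *\<^sub>R g \<in> {g. \<forall>x\<in>K. \<bar>pairing g x - pairing b x\<bar> < e}"
        by (simp only:, blast)
      then show False using V by blast
    qed
  qed
  then obtain x where x: "\<And>g. g \<in> span (insert b M) \<Longrightarrow> F g = pairing g x" by blast
  have "pairing m x = 0" if "m \<in> M" for m
    using x[of m] F(2)[OF that] that by (simp add: span_base)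
  moreover have "pairing b x = 1" using x[of b] F(3) by (simp add: span_base)
  ultimately show "\<exists>x. (\<forall>m\<in>M. pairing m x = 0) \<and> pairing b x = 1" by blast
qed

lemma annihilator_separated_insert:
  assumes M: "annihilator_separated M" and sub: "subspace M"
  shows "annihilator_separated (span (insert b M))"
proof (cases "b \<in> M")
  case True
  then show ?thesis using assms by (simp add: insert_absorb span_eq_iff[THEN iffD2])
next
  case False
  then obtain x where x: "\<And>m. m \<in> M \<Longrightarrow> pairing m x = 0" "pairing b x = 1"
    using M unfolding annihilator_separated_def by blast
  show ?thesis
    unfolding annihilator_separated_def
  proof (intro allI impI)
    fix h assume h: "h \<notin> span (insert b M)"
    \<comment> \<open>The multiple of \<open>b\<close> anticipates a correction: \<open>y\<close>
      minus \<open>pairing b y\<close> times \<open>x\<close> vanishes at \<open>b\<close>, and its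
      value at \<open>h\<close> is that of \<open>y\<close> at
      \<open>h - pairing h x b\<close>.\<close>
    have "h - pairing h x *\<^sub>R b \<notin> M"
      using h sub by (auto simp: span_breakdown_eq span_eq_iff[THEN iffD2])
    then obtain y where y: "\<And>m. m \<in> M \<Longrightarrow> pairing m y = 0" "pairing (h - pairing h x *\<^sub>R b) y = 1"
      using M unfolding annihilator_separated_def by blast
    define z where "z = y + (- pairing b y) *\<^sub>R x"
    have "pairing m z = 0" if m: "m \<in> span (insert b M)" for m
    proof -
      obtain t where t: "m - t *\<^sub>R b \<in> M"
        using m sub by (auto simp: span_breakdown_eq span_eq_iff[THEN iffD2])
      have "pairing (m - t *\<^sub>R b) z = 0" using x(1)[OF t] y(1)[OF t] by (simp add: z_def del: pairing_minus)
      moreover have "pairing b z = 0" using x(2) by (simp add: z_def)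
      ultimately show ?thesis by simp
    qed
    moreover have "pairing h z = 1" using y(2) by (simp add: z_def algebra_simps)
    ultimately show "\<exists>x. (\<forall>m\<in>span (insert b M). pairing m x = 0) \<and> pairing h x = 1" by blast
  qed
qed

text \<open>For \<open>b \<notin> M\<close> some point vanishes on \<open>M\<close> and is 1 at
  \<open>b\<close>. A multiple of it added to \<open>x\<close> corrects the value at
  \<open>b\<close> without disturbing \<open>M\<close>.\<close>

lemma represented_on_finite_extension:
  fixes F :: "'a::locally_convex_t2_space dual \<Rightarrow> real"
  assumes F: "linear F" and "finite B" "subspace M" "annihilator_separated M"
    and "\<forall>g\<in>M. F g = pairing g x"
  shows "\<exists>y. \<forall>g\<in>span (M \<union> B). F g = pairing g y"
  using assms(2-)
proof (induction B arbitrary: M x rule: finite_induct)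
  case empty
  then show ?case by (auto simp: span_eq_iff[THEN iffD2])
next
  case (insert b B)
  let ?M = "span (insert b M)"
  have "\<exists>z. \<forall>g\<in>?M. F g = pairing g z"
  proof (cases "b \<in> M")
    case True
    then show ?thesis using insert.prems by (auto simp: insert_absorb span_eq_iff[THEN iffD2])
  next
    case False
    then obtain y where y: "\<And>m. m \<in> M \<Longrightarrow> pairing m y = 0" "pairing b y = 1"
      using insert.prems unfolding annihilator_separated_def by blast
    define z where "z = x + (F b - pairing b x) *\<^sub>R y"
    have "F g = pairing g z" if g: "g \<in> ?M" for g
    proof -
      obtain t where t: "g - t *\<^sub>R b \<in> M"
        using g insert.prems(1) by (auto simp: span_breakdown_eq span_eq_iff[THEN iffD2])
      have "F (g - t *\<^sub>R b) = pairing (g - t *\<^sub>R b) z"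
        using insert.prems(3) t y(1)[OF t] by (simp add: z_def del: pairing_minus)
      moreover have "F b = pairing b z" using y(2) by (simp add: z_def)
      ultimately show ?thesis by (simp add: linear_diff[OF F] linear_scale[OF F])
    qed
    then show ?thesis by blast
  qed
  then obtain z where "\<forall>g\<in>?M. F g = pairing g z" by blast
  then have "\<exists>y. \<forall>g\<in>span (?M \<union> B). F g = pairing g y"
    using insert.prems annihilator_separated_insert by (intro insert.IH[of ?M z]) auto
  moreover have "M \<union> insert b B \<subseteq> span (?M \<union> B)"
    by (auto intro!: span_base)
  then have "span (M \<union> insert b B) \<subseteq> span (?M \<union> B)"
    by (simp add: span_minimal)
  ultimately show ?case by blast
qed

section \<open>Separation from the union of the finite sums\<close>

text \<open>Hahn-Banach gives an algebraic functional. The Mackey ball around \<open>a\<close> makes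
  it a point of \<open>X\<close> on \<open>span A\<close>, and closedness with finite codimension
  carries this to the whole dual. The strict inequality rules out equality throughout
  \<open>C\<close>.\<close>

lemma separate_point_from_convex:
  fixes A C :: "'a::locally_convex_t2_space dual set"
  assumes C: "convex C" "A \<subseteq> C" and A0: "0 \<in> A"
    and closed: "closedin mackey_topology (span A)"
    and B: "finite B" "span (span A \<union> B) = UNIV"
    and K: "weak_disk K" and e: "0 < e" and a: "a \<in> A"
    and nbhd: "\<forall>g\<in>span A. (\<forall>x\<in>K. \<bar>pairing g x - pairing a x\<bar> < e) \<longrightarrow> g \<in> A"
    and z: "z \<notin> C"
  shows "\<exists>x. (\<forall>c\<in>C. pairing c x \<le> pairing z x) \<and> (\<exists>c\<in>C. pairing c x < pairing z x)"
proof -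
  define P where "P = cone hull ((\<lambda>c. c - z) ` C)"
  have P_eq: "P = {t *\<^sub>R (c - z) | t c. 0 \<le> t \<and> c \<in> C}"
    unfolding P_def cone_hull_expl by auto
  have C0: "0 \<in> C" using A0 C(2) by blast
  have scale: "t *\<^sub>R p \<in> P" if "0 \<le> t" "p \<in> P" for t p
    unfolding P_def using that by (simp add: mem_cone cone_cone_hull P_def)
  have "convex P"
    unfolding P_def using C(1) by (intro convex_cone_hull convex_translation_subtract)
  moreover have "cone P" by (simp add: P_def cone_cone_hull)
  ultimately have add: "p + q \<in> P" if "p \<in> P" "q \<in> P" for p q
    using that convex_cone[of P] by blast
  have CP: "c - z \<in> P" if "c \<in> C" for c
    using that unfolding P_def by (intro hull_inc) blast
  \<comment> \<open>\<open>z = t (c - z)\<close> would make \<open>z\<close> a convex combination of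
    \<open>0\<close> and \<open>c\<close>, with weight \<open>t / (1 + t)\<close> at
    \<open>c\<close>.\<close>
  have zP: "z \<notin> P"
  proof
    assume "z \<in> P"
    then obtain t c where t: "0 \<le> t" "c \<in> C" "z = t *\<^sub>R (c - z)"
      unfolding P_eq by blast
    have "(1 + t) *\<^sub>R z = t *\<^sub>R c" using t(3) by (simp add: algebra_simps)
    then have "inverse (1 + t) *\<^sub>R (1 + t) *\<^sub>R z = inverse (1 + t) *\<^sub>R t *\<^sub>R c" by simp
    then have "z = (t / (1 + t)) *\<^sub>R c"
      using t(1) by (simp add: divide_inverse mult.commute)
    also have "\<dots> = (1 - t / (1 + t)) *\<^sub>R 0 + (t / (1 + t)) *\<^sub>R c" by simp
    also have "\<dots> \<in> C"
      using t(1,2) C0 by (intro convexD_alt[OF C(1)]) auto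
    finally show False using z by simp
  qed
  have core: "\<exists>d>0. (a - z) + d *\<^sub>R v \<in> P" if v: "v \<in> span A" for v
  proof -
    obtain y where y: "y \<in> K" "\<forall>x\<in>K. \<bar>pairing v x\<bar> \<le> pairing v y"
      using weak_disk_attains_bound[OF K, of v] by (rule bexE)
    have m: "0 \<le> pairing v y" using y by fastforce
    define d where "d = e / (pairing v y + 1)"
    have d: "0 < d" "d * pairing v y < e"
      using e m by (auto simp: d_def field_simps)
    have "a + d *\<^sub>R v \<in> A"
    proof (rule nbhd[rule_format])
      show "a + d *\<^sub>R v \<in> span A"
        using a v by (intro span_add span_scale) (auto intro: span_base)
      fix x assume "x \<in> K"
      then have "d * \<bar>pairing v x\<bar> \<le> d * pairing v y" using y(2) d(1) by (intro mult_left_mono) auto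
      then have "d * \<bar>pairing v x\<bar> < e" using d(2) by linarith
      then show "\<bar>pairing (a + d *\<^sub>R v) x - pairing a x\<bar> < e"
        using d(1) by (simp add: abs_mult)
    qed
    then have "(a + d *\<^sub>R v) - z \<in> P" using C(2) CP by blast
    then show ?thesis using d(1) by (intro exI[of _ d]) (simp add: algebra_simps)
  qed
  \<comment> \<open>Taking the missing directions from \<open>P\<close> itself lets them be added to
    the interior point \<open>a - z\<close>.\<close>
  obtain T where T: "finite T" "T \<subseteq> P" "P \<subseteq> span (span A \<union> T)"
    using finite_spanning_subset[OF B(1), of P "span A"] B(2) by auto
  let ?S = "span (span A \<union> T)"
  have "a - z \<in> P" using CP a C(2) by blast
  then have "\<exists>k\<in>P. \<forall>v\<in>?S. \<exists>d>0. k + d *\<^sub>R v \<in> P"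
    using core by (intro cone_core_extend[OF add scale T(1,2)]) (auto simp: span_span)
  then obtain k where k: "k \<in> P" "\<And>v. v \<in> ?S \<Longrightarrow> \<exists>d>0. k + d *\<^sub>R v \<in> P"
    by blast
  \<comment> \<open>\<open>?S\<close> may be smaller than the dual, so the preimage of
    \<open>P\<close> under a projection is used: a cone with \<open>k\<close> as algebraic interior
    point in the full space.\<close>
  obtain \<pi> where \<pi>: "linear \<pi>" "range \<pi> \<subseteq> ?S" "\<And>v. v \<in> ?S \<Longrightarrow> \<pi> v = v"
    using subspace_linear_projection[OF subspace_span, of "span A \<union> T"] by blast
  have \<pi>P: "\<pi> p = p" if "p \<in> P" for p using that T(3) \<pi>(3) by blast
  \<comment> \<open>\<open>- z = 0 - z\<close> lies in \<open>P\<close>, so \<open>\<pi>\<close>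
    fixes \<open>z\<close>; as \<open>z \<notin> P\<close>, the preimage is proper.\<close>
  have "- z \<in> ?S" using CP[OF C0] T(3) by auto
  then have "\<pi> z = z" by (intro \<pi>(3)) (metis minus_minus span_neg)
  then have proper: "{v. \<pi> v \<in> P} \<noteq> UNIV" using zP by (metis UNIV_I mem_Collect_eq)
  have "\<exists>F. linear F \<and> (\<forall>x\<in>{v. \<pi> v \<in> P}. F x \<le> 0) \<and> F k < (0::real)"
  proof (rule exists_linear_neg_on_cone)
    show "\<exists>d>0. k + d *\<^sub>R v \<in> {v. \<pi> v \<in> P}" for v
      using k(2)[of "\<pi> v"] \<pi>(2) \<pi>P[OF k(1)]
      by (auto simp: linear_add[OF \<pi>(1)] linear_scale[OF \<pi>(1)])
  qed (use proper add scale k(1) \<pi>P in \<open>auto simp: linear_add[OF \<pi>(1)] linear_scale[OF \<pi>(1)]\<close>)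
  then obtain F :: "'a dual \<Rightarrow> real" where F: "linear F" "\<And>p. p \<in> P \<Longrightarrow> F p \<le> 0" "F k < 0"
    using \<pi>P by fastforce
  have "\<exists>x. \<forall>g\<in>span A. F g = pairing g x"
  proof (rule mackey_bounded_functional_represented[OF F(1) subspace_span K e])
    fix g assume g: "g \<in> span A" "\<And>x. x \<in> K \<Longrightarrow> \<bar>pairing g x\<bar> < e"
    \<comment> \<open>For small \<open>g\<close> the point \<open>a + g\<close> stays in
      \<open>A\<close>, which bounds \<open>F g\<close> by the constant
      \<open>- F (a - z)\<close>.\<close>
    have "a + g \<in> A"
      using g a by (intro nbhd[rule_format] span_add) (auto intro: span_base)
    then have "F (g + (a - z)) \<le> 0"
      using CP[of "a + g"] C(2) by (intro F(2)) (auto simp: algebra_simps)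
    then show "F g \<le> - F (a - z)" by (simp add: linear_add[OF F(1)])
  qed
  then obtain x0 where "\<forall>g\<in>span A. F g = pairing g x0" by blast
  then have "\<exists>x. \<forall>g\<in>span (span A \<union> B). F g = pairing g x"
    by (rule represented_on_finite_extension[OF F(1) B(1) subspace_span
          mackey_closed_annihilator_separated[OF subspace_span closed]])
  then obtain x where x: "\<And>g. F g = pairing g x" using B(2) by auto
  have "pairing c x \<le> pairing z x" if "c \<in> C" for c
    using F(2)[OF CP[OF that]] by (simp add: x)
  moreover obtain t c where t: "0 \<le> t" "c \<in> C" "k = t *\<^sub>R (c - z)"
    using k(1) unfolding P_eq by blast
  have "pairing c x < pairing z x"
    using F(3) t(1) by (simp add: x t(3) mult_less_0_iff)
  ultimately show ?thesis using t(2) by blast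
qed

lemma indicator_fun_dom: "eff_dom (indicator_fun A) = A"
  by (auto simp: eff_dom_def indicator_fun_def)

text \<open>Since \<open>0 \<in> A\<close>, the affine hull of the effective domain is
  \<open>span A\<close>. A relative interior point \<open>a\<close> supplies a Mackey ball whose
  trace on \<open>span A\<close> lies in \<open>A\<close>.\<close>

lemma mackey_quasicontinuous_indicatorE:
  fixes A :: "'a::locally_convex_t2_space dual set"
  assumes mq: "mackey_quasicontinuous (indicator_fun A)" and A0: "0 \<in> A"
  obtains B K e a where
    "closedin mackey_topology (span A)" "finite B" "span (span A \<union> B) = UNIV"
    "weak_disk K" "0 < e" "a \<in> A"
    "\<forall>g\<in>span A. (\<forall>x\<in>K. \<bar>pairing g x - pairing a x\<bar> < e) \<longrightarrow> g \<in> A"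
proof -
  have aff: "affine hull A = span A"
    using A0 by (intro affine_hull_span_0 hull_inc)
  have closed: "closedin mackey_topology (span A)"
    and codim: "finite_codimension (span A)" and ri: "mackey_ri A \<noteq> {}"
    using mq by (auto simp: mackey_quasicontinuous_def indicator_fun_dom aff)
  obtain B where B: "finite B"
    "span ({u - v | u v. u \<in> span A \<and> v \<in> span A} \<union> B) = UNIV"
    using codim unfolding finite_codimension_def by blast
  have "{u - v | u v. u \<in> span A \<and> v \<in> span A} \<subseteq> span A"
    by (auto intro: span_diff)
  then have "span ({u - v | u v. u \<in> span A \<and> v \<in> span A} \<union> B) \<subseteq> span (span A \<union> B)"
    by (intro span_mono) auto
  then have spanB: "span (span A \<union> B) = UNIV" using B(2) by auto
  obtain a where "a \<in> subtopology mackey_topology (span A) interior_of A"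
    using ri by (auto simp: mackey_ri_def aff)
  then obtain T where T: "openin (subtopology mackey_topology (span A)) T" "a \<in> T" "T \<subseteq> A"
    by (auto simp: interior_of_def)
  then obtain V where V: "openin mackey_topology V" "T = V \<inter> span A"
    by (auto simp: openin_subtopology)
  have "a \<in> V" using T V by blast
  from mackey_basic_nbhd[OF V(1) this]
  obtain K e where K: "weak_disk K" "0 < e" "{g. \<forall>x\<in>K. \<bar>pairing g x - pairing a x\<bar> < e} \<subseteq> V"
    by blast
  show thesis
  proof (rule that[OF closed B(1) spanB K(1,2)])
    show "a \<in> A" using T by blast
    show "\<forall>g\<in>span A. (\<forall>x\<in>K. \<bar>pairing g x - pairing a x\<bar> < e) \<longrightarrow> g \<in> A"
      using K(3) V(2) T(3) by blast
  qed
qed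

text \<open>The half-space \<open>{g. pairing g x \<le> 0}\<close> is weak-star closed and contains
  the cone, hence its closure. A subspace inside a half-space lies in the bounding
  hyperplane.\<close>

lemma no_separation_of_closed_cone_subspace:
  fixes C :: "'a::locally_convex_t2_space dual set"
  assumes sub: "subspace (weak_star_topology closure_of (cone hull (insert 0 ((\<lambda>f. f - z) ` C))))"
    and le: "\<And>c. c \<in> C \<Longrightarrow> pairing c x \<le> pairing z x"
    and c: "c \<in> C"
  shows "pairing c x = pairing z x"
proof -
  let ?P = "cone hull (insert 0 ((\<lambda>f. f - z) ` C))"
  let ?L = "weak_star_topology closure_of ?P"
  have "closedin weak_star_topology {g. pairing g x \<le> 0}"
    using closedin_continuous_map_preimage[OF continuous_map_weak_star_eval, of "{..0}" x] by simp
  moreover have "?P \<subseteq> {g. pairing g x \<le> 0}"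
    using le by (auto simp: cone_hull_expl mult_nonneg_nonpos)
  ultimately have L: "?L \<subseteq> {g. pairing g x \<le> 0}"
    by (rule closure_of_minimal[rotated])
  have "c - z \<in> ?P" using c by (intro hull_inc) auto
  then have "c - z \<in> ?L"
    using closure_of_subset[of ?P weak_star_topology] by auto
  then have "- (c - z) \<in> ?L" by (rule subspace_neg[OF sub])
  then show ?thesis using L le[OF c] by auto
qed

section \<open>Minkowski sums over finite index sets and weak duality\<close>

text \<open>Missing summands are filled in by \<open>0\<close>.\<close>

lemma set_sum_mono:
  fixes A :: "'i \<Rightarrow> 'b::comm_monoid_add set"
  assumes "finite J'" "J \<subseteq> J'" "\<And>i. i \<in> J' \<Longrightarrow> 0 \<in> A i"
  shows "(\<Sum>j\<in>J. A j) \<subseteq> (\<Sum>j\<in>J'. A j)"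
proof
  fix f assume "f \<in> (\<Sum>j\<in>J. A j)"
  then obtain s where s: "f = sum s J" "\<forall>i\<in>J. s i \<in> A i"
    using set_sum_alt[of J A] finite_subset[OF assms(2,1)] by auto
  define s' where "s' i = (if i \<in> J then s i else 0)" for i
  have "f = sum s' J'"
    using assms(1,2) s(1) by (simp add: s'_def sum.inter_restrict[symmetric] Int_absorb1)
  moreover have "\<forall>i\<in>J'. s' i \<in> A i" using s(2) assms(3) by (simp add: s'_def)
  ultimately show "f \<in> (\<Sum>j\<in>J'. A j)"
    using set_sum_alt[OF assms(1), of A] by blast
qed

text \<open>The sums are directed: two points lie in the common convex sum over
  \<open>J \<union> J'\<close>.\<close>

lemma convex_Union_finite_sums:
  fixes A :: "'i \<Rightarrow> 'b::real_vector set"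
  assumes "\<And>i. i \<in> I \<Longrightarrow> convex (A i)" "\<And>i. i \<in> I \<Longrightarrow> 0 \<in> A i"
  shows "convex (\<Union>J\<in>nonempty_finite_subsets I. \<Sum>j\<in>J. A j)"
proof (rule convexI)
  fix f g and u v :: real
  assume uv: "0 \<le> u" "0 \<le> v" "u + v = 1"
    and "f \<in> (\<Union>J\<in>nonempty_finite_subsets I. \<Sum>j\<in>J. A j)"
    and "g \<in> (\<Union>J\<in>nonempty_finite_subsets I. \<Sum>j\<in>J. A j)"
  then obtain J J' where J: "J \<in> nonempty_finite_subsets I" "f \<in> (\<Sum>j\<in>J. A j)"
    and J': "J' \<in> nonempty_finite_subsets I" "g \<in> (\<Sum>j\<in>J'. A j)"
    by blast
  have U: "J \<union> J' \<in> nonempty_finite_subsets I"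
    using J(1) J'(1) by (auto simp: nonempty_finite_subsets_def)
  then have fg: "f \<in> (\<Sum>j\<in>J \<union> J'. A j)" "g \<in> (\<Sum>j\<in>J \<union> J'. A j)"
    using set_sum_mono[of "J \<union> J'" J A] set_sum_mono[of "J \<union> J'" J' A] J(2) J'(2) assms(2)
    by (auto simp: nonempty_finite_subsets_def subset_iff)
  have "convex (\<Sum>j\<in>J \<union> J'. A j)"
    using U assms(1) by (intro convex_set_sum) (auto simp: nonempty_finite_subsets_def)
  then have "u *\<^sub>R f + v *\<^sub>R g \<in> (\<Sum>j\<in>J \<union> J'. A j)"
    using fg uv by (intro convexD)
  then show "u *\<^sub>R f + v *\<^sub>R g \<in> (\<Union>J\<in>nonempty_finite_subsets I. \<Sum>j\<in>J. A j)"
    using U by blast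
qed

text \<open>Weak duality: splitting \<open>z\<close> into summands \<open>s j \<in> A j\<close>
  bounds \<open>pairing z x\<close> by the sum of the support functions over
  \<open>J\<close>.\<close>

lemma robust_sum_support_lower:
  fixes A :: "'i \<Rightarrow> 'a::locally_convex_t2_space dual set"
  assumes J: "J \<in> nonempty_finite_subsets I" and z: "z \<in> (\<Sum>j\<in>J. A j)"
  shows "ereal (- (\<Sum>j\<in>J. t j)) \<le>
    robust_sum I (\<lambda>i x. support_fun (A i) x - ereal (t i)) x - ereal (pairing z x)"
proof -
  have fin: "finite J" using J by (simp add: nonempty_finite_subsets_def)
  obtain s where s: "z = sum s J" "\<forall>i\<in>J. s i \<in> A i"
    using z set_sum_alt[OF fin, of A] by auto
  have "ereal (pairing z x - (\<Sum>j\<in>J. t j)) = (\<Sum>j\<in>J. ereal (pairing (s j) x) - ereal (t j))"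
    by (simp add: s(1) pairing_sum sum_subtractf)
  also have "\<dots> \<le> (\<Sum>j\<in>J. support_fun (A j) x - ereal (t j))"
    using s(2) unfolding support_fun_def by (intro sum_mono ereal_minus_mono SUP_upper) auto
  also have "\<dots> \<le> robust_sum I (\<lambda>i x. support_fun (A i) x - ereal (t i)) x"
    unfolding robust_sum_def using J by (rule SUP_upper)
  finally have "ereal (pairing z x - (\<Sum>j\<in>J. t j)) - ereal (pairing z x) \<le>
      robust_sum I (\<lambda>i x. support_fun (A i) x - ereal (t i)) x - ereal (pairing z x)"
    by (rule ereal_minus_mono) simp
  then show ?thesis by simp
qed

section \<open>Equality and attainment at the origin\<close>

theorem proposition5p2:
  fixes I :: "'i set"
    and A :: "'i \<Rightarrow> 'a::locally_convex_t2_space dual set"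
    and t :: "'i \<Rightarrow> real"
    and xbar :: "'a dual"
  assumes "infinite I"
    and "\<And>i. i \<in> I \<Longrightarrow> A i \<noteq> {} \<and> closedin weak_star_topology (A i) \<and> convex (A i)"
    and "0 \<in> (\<Inter>i\<in>I. A i)"
    and "(SUP i\<in>I. ereal (t i)) \<le> 0"
    and "\<exists>i0\<in>I. mackey_quasicontinuous (indicator_fun (A i0))"
    and "subspace (weak_star_topology closure_of
           (cone hull (insert 0
             ((\<lambda>f. f - xbar) ` (\<Union>J\<in>nonempty_finite_subsets I. \<Sum>j\<in>J. A j)))))"
  shows "is_attained_min
           (\<lambda>x. robust_sum I (\<lambda>i x. support_fun (A i) x - ereal (t i)) x - ereal (pairing xbar x))
           (SUP J\<in>{J \<in> nonempty_finite_subsets I. xbar \<in> (\<Sum>j\<in>J. A j)}. ereal (- (\<Sum>j\<in>J. t j)))"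
proof -
  let ?C = "\<Union>J\<in>nonempty_finite_subsets I. \<Sum>j\<in>J. A j"
  let ?\<phi> = "\<lambda>x. robust_sum I (\<lambda>i x. support_fun (A i) x - ereal (t i)) x - ereal (pairing xbar x)"
  let ?m = "SUP J\<in>{J \<in> nonempty_finite_subsets I. xbar \<in> (\<Sum>j\<in>J. A j)}. ereal (- (\<Sum>j\<in>J. t j))"
  have A0: "0 \<in> A i" if "i \<in> I" for i using assms(3) that by blast
  have t: "t i \<le> 0" if "i \<in> I" for i
  proof -
    have "ereal (t i) \<le> 0" using assms(4) that by (auto simp: SUP_le_iff)
    then show ?thesis by simp
  qed
  obtain i0 where i0: "i0 \<in> I" "mackey_quasicontinuous (indicator_fun (A i0))"
    using assms(5) by blast
  have "xbar \<in> ?C"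
  proof (rule ccontr)
    assume "xbar \<notin> ?C"
    have "convex ?C" using assms(2) A0 by (intro convex_Union_finite_sums) auto
    moreover have "A i0 \<subseteq> ?C"
      using i0(1) by (intro subsetI UN_I[of "{i0}"]) (auto simp: nonempty_finite_subsets_def)
    moreover note A0[OF i0(1)]
    moreover obtain B K e a where
      "closedin mackey_topology (span (A i0))" "finite B" "span (span (A i0) \<union> B) = UNIV"
      "weak_disk K" "0 < e" "a \<in> A i0"
      "\<forall>g\<in>span (A i0). (\<forall>x\<in>K. \<bar>pairing g x - pairing a x\<bar> < e) \<longrightarrow> g \<in> A i0"
      using i0(2) A0[OF i0(1)] by (rule mackey_quasicontinuous_indicatorE) blast
    ultimately obtain x c where x: "\<forall>c\<in>?C. pairing c x \<le> pairing xbar x"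
      and c: "c \<in> ?C" "pairing c x < pairing xbar x"
      using separate_point_from_convex[of ?C "A i0" B K e a xbar] \<open>xbar \<notin> ?C\<close> by blast
    have "pairing c x = pairing xbar x"
      using assms(6) x[rule_format] c(1) by (rule no_separation_of_closed_cone_subspace)
    with c(2) show False by simp
  qed
  then obtain J0 where J0: "J0 \<in> nonempty_finite_subsets I" "xbar \<in> (\<Sum>j\<in>J0. A j)" by blast
  have lower: "?m \<le> ?\<phi> x" for x
    by (rule SUP_least) (auto intro: robust_sum_support_lower)
  have "?\<phi> 0 \<le> ?m"
  proof -
    have "(\<Sum>i\<in>J. support_fun (A i) 0 - ereal (t i)) \<le> ?m" if J: "J \<in> nonempty_finite_subsets I" for J
    proof -
      \<comment> \<open>Joining \<open>J0\<close> puts \<open>xbar\<close> into the sum of sets, and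
        since every \<open>t i \<le> 0\<close> on \<open>I\<close> it can only raise the negated sum
        of the \<open>t i\<close>.\<close>
      let ?U = "J \<union> J0"
      have U: "?U \<in> nonempty_finite_subsets I"
        using J J0(1) by (auto simp: nonempty_finite_subsets_def)
      then have fin: "finite ?U" "?U \<subseteq> I" by (auto simp: nonempty_finite_subsets_def)
      have "support_fun (A i) 0 = 0" if "i \<in> J" for i
      proof -
        have "A i \<noteq> {}" using A0[of i] that fin(2) by blast
        then show ?thesis by (simp add: support_fun_def flip: zero_ereal_def)
      qed
      then have "(\<Sum>i\<in>J. support_fun (A i) 0 - ereal (t i)) = (\<Sum>i\<in>J. ereal (- t i))"
        by (intro sum.cong) auto
      also have "\<dots> = ereal (- (\<Sum>i\<in>J. t i))" by (simp add: sum_negf)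
      also have "\<dots> \<le> ereal (- (\<Sum>i\<in>?U. t i))"
        using fin t sum_mono2[of ?U J "\<lambda>i. - t i"] by (auto simp: sum_negf)
      also have "\<dots> \<le> ?m"
      proof (rule SUP_upper)
        have "xbar \<in> (\<Sum>j\<in>?U. A j)"
          using set_sum_mono[of ?U J0 A] fin A0 J0(2) by blast
        then show "?U \<in> {J \<in> nonempty_finite_subsets I. xbar \<in> (\<Sum>j\<in>J. A j)}" using U by simp
      qed
      finally show ?thesis .
    qed
    then show ?thesis
      unfolding robust_sum_def by (auto simp: zero_ereal_def[symmetric] intro!: SUP_least)
  qed
  then have eq: "?\<phi> 0 = ?m" using lower by (rule antisym)
  moreover have "(INF x. ?\<phi> x) = ?m"
  proof (rule antisym)
    show "(INF x. ?\<phi> x) \<le> ?m" using INF_lower[of 0 UNIV ?\<phi>] eq by simp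
    show "?m \<le> (INF x. ?\<phi> x)" using lower by (intro INF_greatest)
  qed
  ultimately show ?thesis unfolding is_attained_min_def by blast
qed

end
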